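(* Let $A$ be the complex vector bundle of rank $2$ over $S^4 \cong \mathbb{H}P^1$ (with unitary structure group) with second Chern class $c_2(A) = 1 \in H^4(S^4;\mathbb{Z}) \cong \mathbb{Z}$, and let $B = \overline{A}$ be the complex conjugate bundle. Then the tensor product bundle $A \otimes B$ over $S^4$ admits a nowhere vanishing continuous section, and for every nowhere vanishing continuous section $\Gamma$ of $A \otimes B$ there is a point $x \in S^4$ at which $\Gamma(x) \in A_x \otimes B_x$ has tensor rank greater than $1$ (i.e. $\Gamma(x)$ is entangled).
   Context: A nonzero vector in $A_x \otimes B_x$ has tensor rank $1$ (is simple, or unentangled) if it can be written $v \otimes w$ with $v \in A_x$, $w \in B_x$; otherwise it is entangled. $\mathbb{H}P^1$ is the quaternionic projective line. *)

theory Defs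
  imports "HOL-Homology.Homology" "HOL-Analysis.Analysis"
begin

section \<open>Complex vector bundles with unitary structure group\<close>

definition conj_mat :: "complex^'n^'m \<Rightarrow> complex^'n^'m" where
  "conj_mat M = (\<chi> r c. cnj (M $ r $ c))"

definition unitary_mat :: "complex^'n^'n \<Rightarrow> bool" where
  "unitary_mat M \<longleftrightarrow> M ** transpose (conj_mat M) = mat 1 \<and> transpose (conj_mat M) ** M = mat 1"

text \<open>A bundle is given by a bundle atlas: an open cover of the base, with coordinate changes
  \<open>transition A i j\<close> from the \<open>j\<close>-th to the \<open>i\<close>-th trivialization.\<close>

record ('i, 'b, 'n::finite) vbundle =
  charts :: "'i set"
  patch :: "'i \<Rightarrow> 'b set"
  transition :: "'i \<Rightarrow> 'i \<Rightarrow> 'b \<Rightarrow> complex^'n^'n"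

definition unitary_vbundle :: "'b topology \<Rightarrow> ('i, 'b, 'n::finite) vbundle \<Rightarrow> bool" where
  "unitary_vbundle X A \<longleftrightarrow>
     (\<forall>i\<in>charts A. openin X (patch A i)) \<and>
     (\<Union>i\<in>charts A. patch A i) = topspace X \<and>
     (\<forall>i\<in>charts A. \<forall>j\<in>charts A.
        continuous_map (subtopology X (patch A i \<inter> patch A j)) euclidean (transition A i j)) \<and>
     (\<forall>i\<in>charts A. \<forall>j\<in>charts A. \<forall>x \<in> patch A i \<inter> patch A j. unitary_mat (transition A i j x)) \<and>
     (\<forall>i\<in>charts A. \<forall>j\<in>charts A. \<forall>k\<in>charts A. \<forall>x \<in> patch A i \<inter> patch A j \<inter> patch A k.
        transition A i j x ** transition A j k x = transition A i k x)"

definition charts_at :: "('i, 'b, 'n::finite) vbundle \<Rightarrow> 'b \<Rightarrow> 'i set" where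
  "charts_at A x = {i \<in> charts A. x \<in> patch A i}"

text \<open>A vector of the fibre over \<open>x\<close> is its family of coordinate vectors, one for each
  trivialization around \<open>x\<close>; the vector space operations are the coordinatewise ones.\<close>

definition fibre :: "('i, 'b, 'n::finite) vbundle \<Rightarrow> 'b \<Rightarrow> ('i \<Rightarrow> complex^'n) set" where
  "fibre A x = {v \<in> extensional (charts_at A x).
     \<forall>i\<in>charts_at A x. \<forall>j\<in>charts_at A x. v i = transition A i j x *v v j}"

definition fibre_zero :: "('i, 'b, 'n::finite) vbundle \<Rightarrow> 'b \<Rightarrow> 'i \<Rightarrow> complex^'n" where
  "fibre_zero A x = (\<lambda>i\<in>charts_at A x. 0)"

text \<open>\<open>triv A i (x, v)\<close> is the point of the total space over \<open>x\<close> with \<open>i\<close>-th coordinate vector \<open>v\<close>.\<close>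

definition triv ::
  "('i, 'b, 'n::finite) vbundle \<Rightarrow> 'i \<Rightarrow> 'b \<times> (complex^'n) \<Rightarrow> 'b \<times> ('i \<Rightarrow> complex^'n)" where
  "triv A i = (\<lambda>(x, v). (x, \<lambda>j\<in>charts_at A x. transition A j i x *v v))"

text \<open>The total space carries the final topology with respect to the local trivializations.\<close>

definition total_space ::
  "'b topology \<Rightarrow> ('i, 'b, 'n::finite) vbundle \<Rightarrow> ('b \<times> ('i \<Rightarrow> complex^'n)) topology" where
  "total_space X A = topology (\<lambda>W. W \<subseteq> Sigma (topspace X) (fibre A) \<and>
     (\<forall>i\<in>charts A. openin (prod_topology (subtopology X (patch A i)) euclidean)
        {p \<in> (topspace X \<inter> patch A i) \<times> UNIV. triv A i p \<in> W}))"

lemma openin_total_space: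
  "openin (total_space X A) W \<longleftrightarrow> W \<subseteq> Sigma (topspace X) (fibre A) \<and>
     (\<forall>i\<in>charts A. openin (prod_topology (subtopology X (patch A i)) euclidean)
        {p \<in> (topspace X \<inter> patch A i) \<times> UNIV. triv A i p \<in> W})"
proof -
  let ?T = "\<lambda>i. prod_topology (subtopology X (patch A i)) (euclidean :: (complex^'c) topology)"
  let ?P = "\<lambda>i W. {p \<in> (topspace X \<inter> patch A i) \<times> UNIV. triv A i p \<in> W}"
  have "?P i (S \<inter> T) = ?P i S \<inter> ?P i T" for i S T
    by auto
  moreover have "?P i (\<Union>K) = \<Union>(?P i ` K)" for i K
    by auto
  ultimately have "istopology (\<lambda>W. W \<subseteq> Sigma (topspace X) (fibre A) \<and>
      (\<forall>i\<in>charts A. openin (?T i) (?P i W)))"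
    unfolding istopology_def by (auto intro!: openin_Int openin_Union)
  then show ?thesis
    unfolding total_space_def by simp
qed

definition continuous_section ::
  "'b topology \<Rightarrow> ('i, 'b, 'n::finite) vbundle \<Rightarrow> ('b \<Rightarrow> 'i \<Rightarrow> complex^'n) \<Rightarrow> bool" where
  "continuous_section X A s \<longleftrightarrow> continuous_map X (total_space X A) (\<lambda>x. (x, s x))"

definition nowhere_vanishing ::
  "'b topology \<Rightarrow> ('i, 'b, 'n::finite) vbundle \<Rightarrow> ('b \<Rightarrow> 'i \<Rightarrow> complex^'n) \<Rightarrow> bool" where
  "nowhere_vanishing X A s \<longleftrightarrow> (\<forall>x\<in>topspace X. s x \<noteq> fibre_zero A x)"


section \<open>Conjugate bundle, tensor product and entanglement\<close>

definition conj_vbundle :: "('i, 'b, 'n::finite) vbundle \<Rightarrow> ('i, 'b, 'n) vbundle" where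
  "conj_vbundle A =
     \<lparr>charts = charts A, patch = patch A, transition = (\<lambda>i j x. conj_mat (transition A i j x))\<rparr>"

text \<open>\<open>\<complex>\<^sup>n \<otimes> \<complex>\<^sup>m\<close> is the space of vectors indexed by pairs.\<close>

definition tensor_vec :: "complex^'n \<Rightarrow> complex^'m \<Rightarrow> complex^('n \<times> 'm)" where
  "tensor_vec v w = (\<chi> p. v $ fst p * w $ snd p)"

definition tensor_mat ::
  "complex^'n^'n \<Rightarrow> complex^'m^'m \<Rightarrow> complex^('n \<times> 'm)^('n \<times> 'm)" where
  "tensor_mat M N = (\<chi> p q. M $ fst p $ fst q * N $ snd p $ snd q)"

definition tensor_vbundle ::
  "('i, 'b, 'n::finite) vbundle \<Rightarrow> ('j, 'b, 'm::finite) vbundle \<Rightarrow> ('i \<times> 'j, 'b, 'n \<times> 'm) vbundle" where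
  "tensor_vbundle A B =
     \<lparr>charts = charts A \<times> charts B,
      patch = (\<lambda>(i, j). patch A i \<inter> patch B j),
      transition = (\<lambda>(i, j) (k, l) x. tensor_mat (transition A i k x) (transition B j l x))\<rparr>"

definition fibre_tensor ::
  "('i, 'b, 'n::finite) vbundle \<Rightarrow> ('j, 'b, 'm::finite) vbundle \<Rightarrow> 'b \<Rightarrow>
     ('i \<Rightarrow> complex^'n) \<Rightarrow> ('j \<Rightarrow> complex^'m) \<Rightarrow> 'i \<times> 'j \<Rightarrow> complex^('n \<times> 'm)" where
  "fibre_tensor A B x v w = (\<lambda>(i, j) \<in> charts_at A x \<times> charts_at B x. tensor_vec (v i) (w j))"

definition simple_at ::
  "('i, 'b, 'n::finite) vbundle \<Rightarrow> ('j, 'b, 'm::finite) vbundle \<Rightarrow> 'b \<Rightarrow>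
     ('i \<times> 'j \<Rightarrow> complex^('n \<times> 'm)) \<Rightarrow> bool" where
  "simple_at A B x t \<longleftrightarrow> t \<noteq> fibre_zero (tensor_vbundle A B) x \<and>
     (\<exists>v\<in>fibre A x. \<exists>w\<in>fibre B x. t = fibre_tensor A B x v w)"

definition entangled_at ::
  "('i, 'b, 'n::finite) vbundle \<Rightarrow> ('j, 'b, 'm::finite) vbundle \<Rightarrow> 'b \<Rightarrow>
     ('i \<times> 'j \<Rightarrow> complex^('n \<times> 'm)) \<Rightarrow> bool" where
  "entangled_at A B x t \<longleftrightarrow> t \<in> fibre (tensor_vbundle A B) x \<and>
     t \<noteq> fibre_zero (tensor_vbundle A B) x \<and> \<not> simple_at A B x t"

lemma conj_mat_mult: "conj_mat (M ** N) = conj_mat M ** conj_mat N"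
  by (simp add: conj_mat_def matrix_matrix_mult_def vec_eq_iff)

lemma conj_mat_transpose: "conj_mat (transpose M) = transpose (conj_mat M)"
  by (simp add: conj_mat_def transpose_def)

lemma conj_mat_1: "conj_mat (mat 1) = mat 1"
  by (simp add: conj_mat_def mat_def vec_eq_iff)


lemma tensor_mat_mult:
  "tensor_mat M N ** tensor_mat M' N' = tensor_mat (M ** M') (N ** N')"
proof -
  have "(\<Sum>k\<in>UNIV. M $ fst p $ fst k * N $ snd p $ snd k * (M' $ fst k $ fst q * N' $ snd k $ snd q)) =
    (\<Sum>k\<in>UNIV. M $ fst p $ k * M' $ k $ fst q) * (\<Sum>k\<in>UNIV. N $ snd p $ k * N' $ k $ snd q)" for p q
    unfolding sum_product sum.cartesian_product UNIV_Times_UNIV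
    by (rule sum.cong) (auto simp: mult.assoc mult.left_commute)
  then show ?thesis
    by (simp add: tensor_mat_def matrix_matrix_mult_def vec_eq_iff)
qed

lemma tensor_mat_vec: "tensor_mat M N *v tensor_vec v w = tensor_vec (M *v v) (N *v w)"
proof -
  have "(\<Sum>k\<in>UNIV. M $ fst p $ fst k * N $ snd p $ snd k * (v $ fst k * w $ snd k)) =
    (\<Sum>k\<in>UNIV. M $ fst p $ k * v $ k) * (\<Sum>k\<in>UNIV. N $ snd p $ k * w $ k)" for p
    unfolding sum_product sum.cartesian_product UNIV_Times_UNIV
    by (rule sum.cong) (auto simp: mult.assoc mult.left_commute)
  then show ?thesis
    by (simp add: tensor_mat_def tensor_vec_def matrix_vector_mult_def vec_eq_iff)
qed

lemma tensor_mat_adjoint: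
  "transpose (conj_mat (tensor_mat M N)) = tensor_mat (transpose (conj_mat M)) (transpose (conj_mat N))"
  by (simp add: tensor_mat_def conj_mat_def transpose_def vec_eq_iff)

lemma tensor_mat_1: "tensor_mat (mat 1) (mat 1) = mat 1"
  by (auto simp: tensor_mat_def mat_def vec_eq_iff prod_eq_iff)

lemma unitary_conj_mat: "unitary_mat M \<Longrightarrow> unitary_mat (conj_mat M)"
  by (simp add: unitary_mat_def conj_mat_1 flip: conj_mat_mult conj_mat_transpose)

lemma unitary_tensor_mat: "unitary_mat M \<Longrightarrow> unitary_mat N \<Longrightarrow> unitary_mat (tensor_mat M N)"
  by (simp add: unitary_mat_def tensor_mat_adjoint tensor_mat_mult tensor_mat_1)

lemma fibre_tensor_in_fibre:
  assumes v: "v \<in> fibre A x" and w: "w \<in> fibre B x"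
  shows "fibre_tensor A B x v w \<in> fibre (tensor_vbundle A B) x"
proof -
  have at: "charts_at (tensor_vbundle A B) x = charts_at A x \<times> charts_at B x"
    by (auto simp: charts_at_def tensor_vbundle_def)
  have tr: "transition (tensor_vbundle A B) p q x =
      tensor_mat (transition A (fst p) (fst q) x) (transition B (snd p) (snd q) x)" for p q
    by (simp add: tensor_vbundle_def case_prod_unfold)
  have eq: "fibre_tensor A B x v w p = tensor_vec (v (fst p)) (w (snd p))"
    if "p \<in> charts_at A x \<times> charts_at B x" for p
    using that by (simp add: fibre_tensor_def case_prod_unfold)
  have "fibre_tensor A B x v w p =
          transition (tensor_vbundle A B) p q x *v fibre_tensor A B x v w q"
    if p: "p \<in> charts_at A x \<times> charts_at B x" and q: "q \<in> charts_at A x \<times> charts_at B x" for p q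
  proof -
    have pq: "fst p \<in> charts_at A x" "fst q \<in> charts_at A x" "snd p \<in> charts_at B x" "snd q \<in> charts_at B x"
      using p q by (simp_all only: mem_Times_iff)
    have "v (fst p) = transition A (fst p) (fst q) x *v v (fst q)"
      using v pq(1,2) unfolding fibre_def by blast
    moreover have "w (snd p) = transition B (snd p) (snd q) x *v w (snd q)"
      using w pq(3,4) unfolding fibre_def by blast
    ultimately show ?thesis
      by (simp only: eq[OF p] eq[OF q] tr tensor_mat_vec)
  qed
  moreover have "fibre_tensor A B x v w \<in> extensional (charts_at A x \<times> charts_at B x)"
    by (simp add: fibre_tensor_def)
  ultimately show ?thesis
    unfolding fibre_def at by (intro CollectI conjI ballI)
qed

lemma unitary_vbundle_conj:
  fixes A :: "('i, 'b, 'c::finite) vbundle"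
  assumes "unitary_vbundle X A"
  shows "unitary_vbundle X (conj_vbundle A)"
proof -
  have "continuous_on UNIV (conj_mat :: complex^'c^'c \<Rightarrow> _)"
    unfolding conj_mat_def by (intro continuous_intros)
  then have "continuous_map euclidean euclidean (conj_mat :: complex^'c^'c \<Rightarrow> _)"
    by simp
  then have "continuous_map Y euclidean (\<lambda>x. conj_mat (f x))"
    if "continuous_map Y euclidean f" for Y :: "'b topology" and f :: "'b \<Rightarrow> complex^'c^'c"
    using continuous_map_compose[OF that, of euclidean conj_mat] by (simp add: o_def)
  then show ?thesis
    using assms by (simp add: unitary_vbundle_def conj_vbundle_def unitary_conj_mat
        flip: conj_mat_mult)
qed

lemma unitary_vbundle_tensor:
  fixes A :: "('i, 'b, 'c::finite) vbundle" and B :: "('j, 'b, 'e::finite) vbundle"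
  assumes A: "unitary_vbundle X A" and B: "unitary_vbundle X B"
  shows "unitary_vbundle X (tensor_vbundle A B)"
proof -
  have "continuous_on UNIV (\<lambda>p. tensor_mat (fst p :: complex^'c^'c) (snd p :: complex^'e^'e))"
    unfolding tensor_mat_def by (intro continuous_intros)
  then have c: "continuous_map (prod_topology euclidean euclidean) euclidean
      (\<lambda>p. tensor_mat (fst p :: complex^'c^'c) (snd p :: complex^'e^'e))"
    by (simp flip: euclidean_product_topology)
  have "continuous_map Y euclidean (\<lambda>x. tensor_mat (f x) (g x))"
    if "continuous_map Y euclidean f" "continuous_map Y euclidean g"
    for Y :: "'b topology" and f :: "_ \<Rightarrow> complex^'c^'c" and g :: "_ \<Rightarrow> complex^'e^'e"
    using continuous_map_compose[OF continuous_map_pairedI[OF that] c] by (simp add: o_def)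
  moreover have "continuous_map (subtopology X (patch A i \<inter> patch B j \<inter> (patch A k \<inter> patch B l)))
      euclidean (transition A i k)" if "i \<in> charts A" "k \<in> charts A" for i j k l
    using A that
    by - (rule continuous_map_from_subtopology_mono[where T = "patch A i \<inter> patch A k"],
      auto simp: unitary_vbundle_def)
  moreover have "continuous_map (subtopology X (patch A i \<inter> patch B j \<inter> (patch A k \<inter> patch B l)))
      euclidean (transition B j l)" if "j \<in> charts B" "l \<in> charts B" for i j k l
    using B that
    by - (rule continuous_map_from_subtopology_mono[where T = "patch B j \<inter> patch B l"],
      auto simp: unitary_vbundle_def)
  moreover have "(\<Union>p\<in>charts A \<times> charts B. patch A (fst p) \<inter> patch B (snd p)) =
      (\<Union>i\<in>charts A. patch A i) \<inter> (\<Union>j\<in>charts B. patch B j)"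
    by auto
  moreover have "(\<Union>i\<in>charts A. patch A i) = topspace X" "(\<Union>j\<in>charts B. patch B j) = topspace X"
    using A B by (auto simp: unitary_vbundle_def)
  ultimately show ?thesis
    using A B unfolding unitary_vbundle_def tensor_vbundle_def
    by (simp add: case_prod_unfold tensor_mat_mult unitary_tensor_mat openin_Int)
qed


section \<open>The second Chern class\<close>

text \<open>The top Chern class of a rank 2 bundle is the Euler class of the underlying oriented real
  rank 4 bundle: the pullback of the Thom class along the zero section.\<close>

definition nonzero_part ::
  "'b topology \<Rightarrow> ('i, 'b, 'n::finite) vbundle \<Rightarrow> ('b \<times> ('i \<Rightarrow> complex^'n)) set" where
  "nonzero_part X A = {(x, v). x \<in> topspace X \<and> v \<in> fibre A x \<and> v \<noteq> fibre_zero A x}"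

text \<open>The complex orientation of \<open>\<complex>\<^sup>2\<close> as a generator of \<open>H\<^sub>4(\<complex>\<^sup>2, \<complex>\<^sup>2 - 0)\<close>: the affine simplex
  around the origin with vertices \<open>- (e\<^sub>1 + \<i> e\<^sub>1 + e\<^sub>2 + \<i> e\<^sub>2), e\<^sub>1, \<i> e\<^sub>1, e\<^sub>2, \<i> e\<^sub>2\<close>,
  which is positively oriented with respect to the real basis \<open>e\<^sub>1, \<i> e\<^sub>1, e\<^sub>2, \<i> e\<^sub>2\<close>.\<close>

definition orientation_simplex :: "(nat \<Rightarrow> real) \<Rightarrow> complex^2" where
  "orientation_simplex = (\<lambda>t\<in>standard_simplex 4.
     vector [Complex (t 1 - t 0) (t 2 - t 0), Complex (t 3 - t 0) (t 4 - t 0)])"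

definition complex_orientation :: "(complex^2) chain set" where
  "complex_orientation = homologous_rel_set 4 euclidean (- {0}) (frag_of orientation_simplex)"

text \<open>\<open>H\<^sup>4(E, E\<^sub>0; \<int>)\<close> and \<open>H\<^sup>4(X; \<int>)\<close> are taken as \<open>Hom(H\<^sub>4(-), \<int>)\<close>. By universal coefficients
  this is the cohomology group when \<open>H\<^sub>3(X)\<close> is free (for \<open>X = S\<^sup>4\<close> it vanishes; \<open>H\<^sub>3(E, E\<^sub>0)\<close>
  vanishes always, by the Thom isomorphism).\<close>

definition thom_class ::
  "'b topology \<Rightarrow> ('i, 'b, 2) vbundle \<Rightarrow> (('b \<times> ('i \<Rightarrow> complex^2)) chain set \<Rightarrow> int) \<Rightarrow> bool" where
  "thom_class X A u \<longleftrightarrow>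
     u \<in> hom (relative_homology_group 4 (total_space X A) (nonzero_part X A)) integer_group \<and>
     (\<forall>i\<in>charts A. \<forall>x\<in>patch A i.
        u (hom_induced 4 euclidean (- {0}) (total_space X A) (nonzero_part X A)
             (\<lambda>v. triv A i (x, v)) complex_orientation) = 1)"

definition second_chern_class ::
  "'b topology \<Rightarrow> ('i, 'b, 2) vbundle \<Rightarrow> ('b chain set \<Rightarrow> int) \<Rightarrow> bool" where
  "second_chern_class X A c \<longleftrightarrow>
     (\<exists>u. thom_class X A u \<and>
        (\<forall>z \<in> carrier (homology_group 4 X).
           c z = u (hom_induced 4 X {} (total_space X A) (nonzero_part X A)
                      (\<lambda>x. (x, fibre_zero A x)) z)))"

text \<open>A generator \<open>z\<close> of an infinite cyclic \<open>H\<^sub>n(X)\<close> fixes the identification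
  \<open>c \<mapsto> c z\<close> of \<open>H\<^sup>n(X; \<int>)\<close> with \<open>\<int>\<close>.\<close>

definition orientation_class :: "'b topology \<Rightarrow> nat \<Rightarrow> 'b chain set \<Rightarrow> bool" where
  "orientation_class X n z \<longleftrightarrow> z \<in> carrier (homology_group (int n) X) \<and>
     subgroup_generated (homology_group (int n) X) {z} = homology_group (int n) X"

abbreviation S4 :: "(real^5) topology" where
  "S4 \<equiv> top_of_set (sphere 0 1)"

end

(* If a nowhere vanishing section G of A (x) conj A were simple everywhere, G(x) = v(x) (x) w(x) with
   v and w determined up to reciprocal scalars, then the lines spanned by v(x) would form a line
   subbundle of A. Line bundles over S^4 are trivial: over boxes of the stereographic chart, nowhere
   vanishing sections are glued along convex sets by means of complex logarithms, and the last gluing,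
   with a cap around the pole, is along a 3-sphere, which is simply connected. Hence A has a
   nowhere vanishing section s. The homotopy t s from the zero section to s pushes the former off
   the zero section, so that c_2(A) = 0. The nowhere vanishing section of A (x) conj A = End A is
   the identity, whose (i, j)-coordinate is the transition matrix g_ij. *)

theory Submission
  imports Defs
begin

section \<open>Line bundles over spheres\<close>

lemma continuous_on_openin_cover:
  assumes "\<And>i. i \<in> I \<Longrightarrow> openin (top_of_set S) (S \<inter> U i)" "S \<subseteq> (\<Union>i\<in>I. U i)"
    and "\<And>i. i \<in> I \<Longrightarrow> continuous_on (S \<inter> U i) f"
  shows "continuous_on S f"
proof -
  have "continuous_map (top_of_set S) euclidean f"
  proof (rule pasting_lemma[where I = I and T = "\<lambda>i. S \<inter> U i" and f = "\<lambda>_. f"])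
    show "continuous_map (subtopology (top_of_set S) (S \<inter> U i)) euclidean f" if "i \<in> I" for i
      using assms(3)[OF that] by (simp add: subtopology_subtopology)
  qed (use assms in auto)
  then show ?thesis by simp
qed

text \<open>The outer induction runs over the set of directions in which the side may exceed
  \<open>d\<close>, the inner one over the number of slabs of thickness \<open>d\<close> needed in
  the direction just added. Cutting along hyperplanes suits the later gluing, where two halves meet
  in a convex set.\<close>

lemma cbox_split_induct:
  fixes P :: "'a::euclidean_space set \<Rightarrow> bool"
  assumes d: "0 < d"
    and small: "\<And>a b. (\<And>i. i \<in> Basis \<Longrightarrow> b \<bullet> i - a \<bullet> i \<le> d) \<Longrightarrow> P (cbox a b)"
    and split: "\<And>a b k c. k \<in> Basis \<Longrightarrow> P (cbox a b \<inter> {x. x \<bullet> k \<le> c}) \<Longrightarrow>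
       P (cbox a b \<inter> {x. c \<le> x \<bullet> k}) \<Longrightarrow> P (cbox a b)"
  shows "P (cbox a b)"
proof -
  have "(\<forall>i\<in>Basis - S. b \<bullet> i - a \<bullet> i \<le> d) \<longrightarrow> P (cbox a b)" if "finite S" "S \<subseteq> Basis" for S and a b :: 'a
    using that
  proof (induction S arbitrary: a b rule: finite_induct)
    case empty
    then show ?case using small by auto
  next
    case (insert k S)
    then have k: "k \<in> Basis" by auto
    have "(\<forall>i\<in>Basis - insert k S. b \<bullet> i - a \<bullet> i \<le> d) \<Longrightarrow> b \<bullet> k - a \<bullet> k \<le> real n * d \<Longrightarrow> P (cbox a b)"
      for n and a b :: 'a
    proof (induction n arbitrary: a b)
      case 0
      then have "\<forall>i\<in>Basis - S. b \<bullet> i - a \<bullet> i \<le> d"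
        using d by force
      then show ?case
        using insert by blast
    next
      case (Suc n)
      \<comment> \<open>The cut takes one slab of thickness \<open>d\<close> off the upper end: the
        lower part needs one slab fewer, and the slab itself is short in direction
        \<open>k\<close>.\<close>
      let ?c = "b \<bullet> k - d"
      show ?case
      proof (rule split[OF k, where c = ?c])
        show "P (cbox a b \<inter> {x. x \<bullet> k \<le> ?c})"
          unfolding interval_split[OF k] using Suc.prems k d
          by (intro Suc.IH) (auto simp: algebra_simps)
        have "\<forall>i\<in>Basis - S. b \<bullet> i - (\<Sum>i\<in>Basis. (if i = k then max (a \<bullet> k) ?c else a \<bullet> i) *\<^sub>R i) \<bullet> i \<le> d"
          using Suc.prems k d by auto
        then show "P (cbox a b \<inter> {x. ?c \<le> x \<bullet> k})"
          unfolding interval_split[OF k] using insert by blast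
      qed
    qed
    moreover obtain n where "b \<bullet> k - a \<bullet> k \<le> real n * d"
      using reals_Archimedean3[OF d] by (meson less_imp_le)
    ultimately show ?case by blast
  qed
  from this[of Basis] show ?thesis by simp
qed

text \<open>The ratios \<open>w j / w i\<close> are the coordinate changes of a line bundle over \<open>X\<close>; the functions
  \<open>w i\<close> themselves need not be continuous. A function \<open>t\<close> as in \<open>trivial_on\<close> is a nowhere
  vanishing section over \<open>K\<close> with coordinates \<open>t / w i\<close>.\<close>

locale nonzero_cocycle =
  fixes X :: "'a::euclidean_space set" and I :: "'i set" and U :: "'i \<Rightarrow> 'a set"
    and w :: "'i \<Rightarrow> 'a \<Rightarrow> complex"
  assumes openin_U: "i \<in> I \<Longrightarrow> openin (top_of_set X) (U i)"
    and cover: "X \<subseteq> (\<Union>i\<in>I. U i)"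
    and nonzero: "i \<in> I \<Longrightarrow> x \<in> U i \<Longrightarrow> w i x \<noteq> 0"
    and continuous_ratio: "i \<in> I \<Longrightarrow> j \<in> I \<Longrightarrow> continuous_on (U i \<inter> U j) (\<lambda>x. w j x / w i x)"
begin

definition trivial_on :: "'a set \<Rightarrow> bool" where
  "trivial_on K \<longleftrightarrow>
     (\<exists>t. (\<forall>x\<in>K. t x \<noteq> 0) \<and> (\<forall>i\<in>I. continuous_on (K \<inter> U i) (\<lambda>x. t x / w i x)))"

text \<open>The local frame of chart \<open>i\<close> is itself a section: its coordinates in the
  other charts are the ratios \<open>w i / w j\<close>, which are continuous by assumption.\<close>

lemma trivial_on_subset_patch:
  assumes "i \<in> I" "K \<subseteq> U i"
  shows "trivial_on K"
  unfolding trivial_on_def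
proof (intro exI[of _ "w i"] conjI ballI)
  show "w i x \<noteq> 0" if "x \<in> K" for x
    using that assms nonzero by blast
  show "continuous_on (K \<inter> U j) (\<lambda>x. w i x / w j x)" if "j \<in> I" for j
    by (rule continuous_on_subset[OF continuous_ratio[OF that \<open>i \<in> I\<close>]]) (use assms in auto)
qed

lemma trivial_on_mono: "trivial_on L \<Longrightarrow> K \<subseteq> L \<Longrightarrow> trivial_on K"
  unfolding trivial_on_def by (meson Int_mono continuous_on_subset order_refl subsetD)

text \<open>The quotient of the two sections over \<open>K \<inter> L\<close> has a logarithm, which Tietze's theorem extends
  to \<open>L\<close>.\<close>

lemma trivial_on_Un:
  assumes "compact K" "compact L" "K \<union> L \<subseteq> X"
    and Bor: "Borsukian (K \<inter> L)"
    and K: "trivial_on K" and L: "trivial_on L"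
  shows "trivial_on (K \<union> L)"
proof -
  obtain s where s: "\<And>x. x \<in> K \<Longrightarrow> s x \<noteq> 0"
      and cs: "\<And>i. i \<in> I \<Longrightarrow> continuous_on (K \<inter> U i) (\<lambda>x. s x / w i x)"
    using K unfolding trivial_on_def by blast
  obtain t where t: "\<And>x. x \<in> L \<Longrightarrow> t x \<noteq> 0"
      and ct: "\<And>i. i \<in> I \<Longrightarrow> continuous_on (L \<inter> U i) (\<lambda>x. t x / w i x)"
    using L unfolding trivial_on_def by blast
  \<comment> \<open>Continuity of \<open>s\<close> and \<open>t\<close> is not given, but over each
    patch \<open>U i\<close> their quotient equals that of the continuous functions
    \<open>s / w i\<close> and \<open>t / w i\<close>.\<close>
  have "continuous_on (K \<inter> L) (\<lambda>x. s x / t x)"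
  proof (rule continuous_on_openin_cover)
    show "K \<inter> L \<subseteq> (\<Union>i\<in>I. U i)"
      using cover assms(3) by blast
    fix i assume i: "i \<in> I"
    obtain V where "open V" "U i = X \<inter> V"
      using openin_U[OF i] unfolding openin_open by blast
    moreover from this have "K \<inter> L \<inter> U i = K \<inter> L \<inter> V"
      using assms(3) by blast
    ultimately show "openin (top_of_set (K \<inter> L)) (K \<inter> L \<inter> U i)"
      by (simp add: openin_open_Int)
    have "continuous_on (K \<inter> L \<inter> U i) (\<lambda>x. (s x / w i x) / (t x / w i x))"
      by (intro continuous_on_divide continuous_on_subset[OF cs[OF i]] continuous_on_subset[OF ct[OF i]])
        (use t nonzero i in auto)
    then show "continuous_on (K \<inter> L \<inter> U i) (\<lambda>x. s x / t x)"
      by (rule continuous_on_eq) (use nonzero i in auto)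
  qed
  moreover have "(\<lambda>x. s x / t x) \<in> K \<inter> L \<rightarrow> - {0}"
    using s t by auto
  ultimately obtain g where cg: "continuous_on (K \<inter> L) g" and g: "\<And>x. x \<in> K \<inter> L \<Longrightarrow> s x / t x = exp (g x)"
    using Bor unfolding Borsukian_continuous_logarithm by blast
  have "closedin (top_of_set L) (K \<inter> L)"
    using \<open>compact K\<close> by (metis closedin_closed_Int compact_imp_closed inf_commute)
  then obtain h where ch: "continuous_on L h" and h: "\<And>x. x \<in> K \<inter> L \<Longrightarrow> h x = g x"
    using Tietze_unbounded[OF cg] by metis
  \<comment> \<open>On \<open>K \<inter> L\<close> the factor \<open>exp h\<close> is exactly
    \<open>s / t\<close>, so the rescaled \<open>t\<close> continues \<open>s\<close>; an
    exponential has no zeros, so the extension is still a nowhere vanishing section.\<close>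
  define r where "r = (\<lambda>x. if x \<in> K then s x else exp (h x) * t x)"
  show ?thesis
    unfolding trivial_on_def
  proof (intro exI[of _ r] conjI ballI)
    show "r x \<noteq> 0" if "x \<in> K \<union> L" for x
      using that s t by (auto simp: r_def)
    fix i assume i: "i \<in> I"
    have "continuous_on (K \<inter> U i \<union> L \<inter> U i) (\<lambda>x. if x \<in> K then s x / w i x else exp (h x) * (t x / w i x))"
    proof (rule continuous_on_cases_local)
      have "K \<inter> U i = (K \<inter> U i \<union> L \<inter> U i) \<inter> K" "L \<inter> U i = (K \<inter> U i \<union> L \<inter> U i) \<inter> L"
        by auto
      then show "closedin (top_of_set (K \<inter> U i \<union> L \<inter> U i)) (K \<inter> U i)"
        "closedin (top_of_set (K \<inter> U i \<union> L \<inter> U i)) (L \<inter> U i)"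
        using assms(1,2) by (metis closedin_closed_Int compact_imp_closed)+
      show "continuous_on (K \<inter> U i) (\<lambda>x. s x / w i x)"
        by (rule cs[OF i])
      show "continuous_on (L \<inter> U i) (\<lambda>x. exp (h x) * (t x / w i x))"
        by (intro continuous_on_mult continuous_on_exp ct[OF i] continuous_on_subset[OF ch]) auto
      fix x assume "x \<in> K \<inter> U i \<and> x \<notin> K \<or> x \<in> L \<inter> U i \<and> x \<in> K"
      then have "x \<in> K \<inter> L"
        by auto
      then show "s x / w i x = exp (h x) * (t x / w i x)"
        using g[of x] h[of x] t[of x] by (simp add: field_simps)
    qed
    then show "continuous_on ((K \<union> L) \<inter> U i) (\<lambda>x. r x / w i x)"
      unfolding Int_Un_distrib2 by (rule continuous_on_eq) (auto simp: r_def)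
  qed
qed

text \<open>Boxes smaller than a Lebesgue number of the pulled back cover land in a single patch.
  Larger ones are reassembled from two halves, whose common part is convex and hence has logarithms
  of all nonvanishing functions.\<close>

lemma trivial_on_image_cbox:
  fixes f :: "'b::euclidean_space \<Rightarrow> 'a"
  assumes f: "continuous_on UNIV f" "inj f" "range f \<subseteq> X"
  shows "trivial_on (f ` cbox a b)"
proof -
  have op: "open (f -` U i)" if i: "i \<in> I" for i
  proof -
    obtain V where "open V" "U i = X \<inter> V"
      using openin_U[OF i] unfolding openin_open by blast
    moreover from this have "f -` U i = f -` V"
      using f(3) by blast
    ultimately show ?thesis
      using open_vimage[OF _ f(1)] by simp
  qed
  show ?thesis
  proof (cases "I = {}")
    case True
    then show ?thesis using cover f(3) by auto
  next
    case False
    have cov: "cbox a b \<subseteq> \<Union>((\<lambda>i. f -` U i) ` I)"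
      using cover f(3) by blast
    obtain \<delta> where \<delta>: "0 < \<delta>"
      "\<And>T. T \<subseteq> cbox a b \<Longrightarrow> diameter T < \<delta> \<Longrightarrow> \<exists>B\<in>(\<lambda>i. f -` U i) ` I. T \<subseteq> B"
      by (rule Lebesgue_number_lemma[of "cbox a b" "(\<lambda>i. f -` U i) ` I"]) (use False op cov in auto)
    \<comment> \<open>The diagonal of a box is at most the sum of its sides; sides of at most
      \<open>d\<close> bound it by half the Lebesgue number.\<close>
    define d where "d = \<delta> / (2 * DIM('b))"
    \<comment> \<open>The trivially true premise puts the goal into the form of the induction
      predicate, which must remember that subboxes stay in \<open>cbox a b\<close>, the set that the
      Lebesgue number refers to.\<close>
    have "cbox a b \<subseteq> cbox a b \<longrightarrow> trivial_on (f ` cbox a b)"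
    proof (rule cbox_split_induct[where P = "\<lambda>S. S \<subseteq> cbox a b \<longrightarrow> trivial_on (f ` S)" and d = d])
      show "0 < d" using \<delta> by (simp add: d_def)
    next
      fix p q :: 'b
      assume pq: "\<And>i. i \<in> Basis \<Longrightarrow> q \<bullet> i - p \<bullet> i \<le> d"
      have "diameter (cbox p q) < \<delta>"
      proof (cases "cbox p q = {}")
        case False
        then have le: "p \<bullet> i \<le> q \<bullet> i" if "i \<in> Basis" for i
          using that by (auto simp: box_ne_empty)
        have "dist p q \<le> (\<Sum>i\<in>Basis. \<bar>(q - p) \<bullet> i\<bar>)"
          by (metis dist_commute dist_norm norm_le_l1)
        also have "\<dots> \<le> (\<Sum>i\<in>(Basis::'b set). d)"
          by (intro sum_mono) (use le pq in \<open>auto simp: inner_diff_left\<close>)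
        also have "\<dots> = \<delta> / 2"
          by (simp add: d_def)
        finally show ?thesis
          using \<delta> le by (simp add: diameter_cbox)
      qed (use \<delta> in auto)
      then have "\<exists>i\<in>I. f ` cbox p q \<subseteq> U i" if "cbox p q \<subseteq> cbox a b"
        using \<delta>(2)[OF that] by auto
      then show "cbox p q \<subseteq> cbox a b \<longrightarrow> trivial_on (f ` cbox p q)"
        using trivial_on_subset_patch by auto
    next
      fix p q k :: 'b and c :: real
      assume k: "k \<in> Basis"
      let ?L = "cbox p q \<inter> {x. x \<bullet> k \<le> c}" and ?R = "cbox p q \<inter> {x. c \<le> x \<bullet> k}"
      assume L: "?L \<subseteq> cbox a b \<longrightarrow> trivial_on (f ` ?L)" and R: "?R \<subseteq> cbox a b \<longrightarrow> trivial_on (f ` ?R)"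
      show "cbox p q \<subseteq> cbox a b \<longrightarrow> trivial_on (f ` cbox p q)"
      proof
        assume sub: "cbox p q \<subseteq> cbox a b"
        have comp: "compact ?L" "compact ?R"
          by (simp_all add: interval_split[OF k])
        have cont: "continuous_on S f" for S
          using f(1) continuous_on_subset by blast
        have "convex (?L \<inter> ?R)"
          by (simp add: interval_split[OF k] convex_Int)
        then have "Borsukian (?L \<inter> ?R)"
          by (rule convex_imp_Borsukian)
        \<comment> \<open>A continuous injection on a compact set is an embedding, so the property
          passes from the common face to its image in the base.\<close>
        moreover have "?L \<inter> ?R homeomorphic f ` (?L \<inter> ?R)"
        proof (rule homeomorphic_compact[where f = f])
          show "compact (?L \<inter> ?R)"
            using comp by (rule compact_Int)
          show "inj_on f (?L \<inter> ?R)"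
            using f(2) by (rule inj_on_subset) simp
        qed (rule cont refl)+
        ultimately have "Borsukian (f ` (?L \<inter> ?R))"
          using homeomorphic_Borsukian by blast
        then have "trivial_on (f ` ?L \<union> f ` ?R)"
          using sub L R comp f(3)
          by (intro trivial_on_Un compact_continuous_image cont) (auto simp: image_Int[OF f(2)])
        moreover have "f ` ?L \<union> f ` ?R = f ` cbox p q"
          unfolding image_Un[symmetric] by (rule arg_cong[where f = "image f"]) auto
        ultimately show "trivial_on (f ` cbox p q)"
          by simp
      qed
    qed
    then show ?thesis by simp
  qed
qed

text \<open>The sphere is the union of a large closed ball of the stereographic chart and a cap
  around the pole that fits into one patch. They meet in a sphere of dimension
  \<open>DIM('b) - 1\<close>, which is at least 2; being simply connected, it admits the logarithm
  needed for gluing.\<close>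

lemma trivial_on_sphere:
  assumes X: "X = sphere 0 1"
    and dim: "DIM('a) = Suc (DIM('b::euclidean_space))" "3 \<le> DIM('b)"
  shows "trivial_on X"
proof -
  obtain e :: 'a where "e \<in> Basis"
    by (meson nonempty_Basis ex_in_conv)
  then have e: "e \<in> X"
    by (simp add: X)
  then obtain i where i: "i \<in> I" "e \<in> U i"
    using cover by blast
  have "(sphere 0 1 - {e}) homeomorphic (UNIV :: 'b set)"
    using e X dim by (intro homeomorphic_punctured_sphere_affine) auto
  then obtain f g where fg: "homeomorphism (X - {e}) UNIV f (g :: 'b \<Rightarrow> 'a)"
    unfolding X homeomorphic_def by blast
  have gX: "range g = X - {e}" and cg: "continuous_on S g" and gf: "\<And>x. x \<in> X - {e} \<Longrightarrow> g (f x) = x"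
    and fg': "\<And>y. f (g y) = y" for S
    using fg continuous_on_subset unfolding homeomorphism_def by auto
  have inj: "inj g"
    using fg' by (metis injI)
  \<comment> \<open>The complement of the patch around the pole is compact and misses the pole, so
    its stereographic image lies in some ball.\<close>
  have "closedin (top_of_set X) (X - U i)"
    using openin_U[OF i(1)] by (simp add: openin_closedin_eq)
  then have "compact (X - U i)"
    using X closedin_compact compact_sphere by blast
  then have "compact (f ` (X - U i))"
    using fg i(2) by (intro compact_continuous_image) (auto simp: homeomorphism_def elim!: continuous_on_subset)
  then obtain R where R: "0 < R" "f ` (X - U i) \<subseteq> ball 0 R"
    by (meson bounded_subset_ballD compact_imp_bounded)
  \<comment> \<open>The previous lemma treats boxes, so the closed ball is first enclosed in
    one.\<close>
  obtain a where a: "cball (0::'b) R \<subseteq> cbox (-a) a"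
    by (meson bounded_cball bounded_subset_cbox_symmetric)
  have tK: "trivial_on (g ` cball 0 R)"
    by (rule trivial_on_mono[OF trivial_on_image_cbox[of g "-a" a]]) (use a gX cg inj in auto)
  \<comment> \<open>Removing the open ball makes the cap compact and leaves exactly the boundary
    sphere as its overlap with the image of the closed ball.\<close>
  let ?L = "X - g ` ball 0 R"
  have "?L \<subseteq> U i"
  proof
    fix x assume x: "x \<in> ?L"
    show "x \<in> U i"
    proof (rule ccontr)
      assume "x \<notin> U i"
      with x i have "f x \<in> ball 0 R" "x \<in> X - {e}"
        using R by auto
      then show False
        using x gf by (metis DiffD2 imageI)
    qed
  qed
  then have tL: "trivial_on ?L"
    by (rule trivial_on_subset_patch[OF i(1)])
  have "openin (top_of_set (X - {e})) (g ` ball 0 R)"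
    using homeomorphism_imp_open_map[of UNIV "X - {e}" g f "ball 0 R"] fg homeomorphism_symD by fastforce
  then have "openin (top_of_set X) (g ` ball 0 R)"
    by (rule openin_trans) (simp add: openin_delete)
  then have "compact ?L"
    using X by (metis closedin_compact compact_sphere openin_closedin_eq topspace_euclidean_subtopology)
  moreover have "g ` cball 0 R \<inter> ?L = g ` sphere 0 R"
  proof -
    have "g ` cball 0 R \<inter> ?L = g ` cball 0 R - g ` ball 0 R"
      using gX by auto
    also have "\<dots> = g ` sphere 0 R"
      by (subst image_set_diff[OF inj, symmetric]) (rule arg_cong[where f = "image g"], auto)
    finally show ?thesis .
  qed
  moreover have "Borsukian (g ` sphere 0 R)"
  proof (rule homeomorphic_Borsukian)
    show "Borsukian (sphere (0::'b) R)"
      by (rule Borsukian_sphere) (use dim in simp)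
    show "sphere (0::'b) R homeomorphic g ` sphere 0 R"
      by (rule homeomorphic_compact[OF compact_sphere cg refl inj_on_subset[OF inj]]) simp
  qed
  moreover have "g ` cball 0 R \<union> ?L = X"
    using gX ball_subset_cball by (auto simp: image_iff)
  ultimately show ?thesis
    using trivial_on_Un[of "g ` cball 0 R" ?L] tK tL by (simp add: compact_continuous_image cg)
qed

end

section \<open>Sections of vector bundles\<close>

lemma fibre_coordinate:
  assumes "v \<in> fibre A x" "i \<in> charts_at A x" "j \<in> charts_at A x"
  shows "v i = transition A i j x *v v j"
  using assms unfolding fibre_def by blast

lemma fibreI:
  assumes "v \<in> extensional (charts_at A x)"
    and "\<And>i j. i \<in> charts_at A x \<Longrightarrow> j \<in> charts_at A x \<Longrightarrow> v i = transition A i j x *v v j"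
  shows "v \<in> fibre A x"
  unfolding fibre_def by (intro CollectI conjI ballI assms)

lemma triv_in_fibre:
  assumes "unitary_vbundle X A" "i \<in> charts A"
  shows "triv A i \<in> (topspace X \<inter> patch A i) \<times> UNIV \<rightarrow> Sigma (topspace X) (fibre A)"
proof
  fix p assume p: "p \<in> (topspace X \<inter> patch A i) \<times> (UNIV :: (complex^'c) set)"
  obtain x v where xv: "p = (x, v)" by fastforce
  have x: "x \<in> topspace X" "i \<in> charts_at A x"
    using p \<open>i \<in> charts A\<close> by (auto simp: xv charts_at_def)
  have "(\<lambda>j\<in>charts_at A x. transition A j i x *v v) \<in> fibre A x"
  proof (rule fibreI)
    fix j k assume jk: "j \<in> charts_at A x" "k \<in> charts_at A x"
    have "transition A j i x = transition A j k x ** transition A k i x"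
      using assms(1) x jk by (simp add: unitary_vbundle_def charts_at_def)
    then show "(\<lambda>j\<in>charts_at A x. transition A j i x *v v) j =
        transition A j k x *v (\<lambda>j\<in>charts_at A x. transition A j i x *v v) k"
      using jk by (simp add: matrix_vector_mul_assoc)
  qed simp
  then show "triv A i p \<in> Sigma (topspace X) (fibre A)"
    using x by (simp add: xv triv_def)
qed

lemma topspace_total_space:
  assumes A: "unitary_vbundle X A"
  shows "topspace (total_space X A) = Sigma (topspace X) (fibre A)"
proof (rule subset_antisym)
  show "topspace (total_space X A) \<subseteq> Sigma (topspace X) (fibre A)"
    using openin_topspace openin_total_space by blast
  have "openin (total_space X A) (Sigma (topspace X) (fibre A))"
    unfolding openin_total_space
  proof (intro conjI ballI order_refl)
    fix i assume "i \<in> charts A"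
    then have "{p \<in> (topspace X \<inter> patch A i) \<times> UNIV. triv A i p \<in> Sigma (topspace X) (fibre A)} =
        topspace (prod_topology (subtopology X (patch A i)) euclidean)"
      using triv_in_fibre[OF A] by auto
    then show "openin (prod_topology (subtopology X (patch A i)) euclidean)
        {p \<in> (topspace X \<inter> patch A i) \<times> UNIV. triv A i p \<in> Sigma (topspace X) (fibre A)}"
      by (metis openin_topspace)
  qed
  then show "Sigma (topspace X) (fibre A) \<subseteq> topspace (total_space X A)"
    by (rule openin_subset)
qed

lemma continuous_map_triv:
  assumes A: "unitary_vbundle X A" and i: "i \<in> charts A"
  shows "continuous_map (prod_topology (subtopology X (patch A i)) euclidean) (total_space X A) (triv A i)"
  unfolding continuous_map_def
proof (intro conjI allI impI)
  show "triv A i \<in> topspace (prod_topology (subtopology X (patch A i)) euclidean) \<rightarrow> topspace (total_space X A)"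
    using triv_in_fibre[OF A i] by (simp add: topspace_total_space[OF A])
  fix W assume "openin (total_space X A) W"
  then show "openin (prod_topology (subtopology X (patch A i)) euclidean)
      {p \<in> topspace (prod_topology (subtopology X (patch A i)) euclidean). triv A i p \<in> W}"
    using i unfolding openin_total_space by simp
qed

lemma triv_coordinate:
  assumes "v \<in> fibre A x" "i \<in> charts_at A x"
  shows "triv A i (x, v i) = (x, v)"
proof -
  have "(\<lambda>j\<in>charts_at A x. transition A j i x *v v i) = v"
  proof (rule extensionalityI)
    show "v \<in> extensional (charts_at A x)"
      using assms(1) unfolding fibre_def by blast
    fix j assume "j \<in> charts_at A x"
    then show "(\<lambda>j\<in>charts_at A x. transition A j i x *v v i) j = v j"
      using fibre_coordinate[OF assms(1) _ assms(2)] by simp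
  qed simp
  then show ?thesis
    by (simp add: triv_def)
qed

text \<open>Over the preimage of a patch the map factors through the trivialization, as
  \<open>triv A i\<close> after the \<open>i\<close>-th coordinate, and the pieces are pasted. The
  base map \<open>f\<close> is kept general to cover both sections, where it is the identity, and
  homotopies of sections, where it is a projection.\<close>

lemma continuous_map_into_total_space:
  assumes A: "unitary_vbundle X A"
    and f: "continuous_map Y X f"
    and s: "\<And>y. y \<in> topspace Y \<Longrightarrow> s y \<in> fibre A (f y)"
    and cont: "\<And>i. i \<in> charts A \<Longrightarrow>
      continuous_map (subtopology Y {y \<in> topspace Y. f y \<in> patch A i}) euclidean (\<lambda>y. s y i)"
  shows "continuous_map Y (total_space X A) (\<lambda>y. (f y, s y))"
proof (rule pasting_lemma[where I = "charts A" and T = "\<lambda>i. {y \<in> topspace Y. f y \<in> patch A i}"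
      and f = "\<lambda>_ y. (f y, s y)"])
  fix i assume i: "i \<in> charts A"
  show "openin Y {y \<in> topspace Y. f y \<in> patch A i}"
    using A f i by (intro openin_continuous_map_preimage[OF f]) (auto simp: unitary_vbundle_def)
  let ?Z = "subtopology Y {y \<in> topspace Y. f y \<in> patch A i}"
  have "continuous_map ?Z (subtopology X (patch A i)) f"
    by (intro continuous_map_into_subtopology continuous_map_from_subtopology f) auto
  then have "continuous_map ?Z (prod_topology (subtopology X (patch A i)) euclidean) (\<lambda>y. (f y, s y i))"
    using cont[OF i] by (rule continuous_map_pairedI)
  then have "continuous_map ?Z (total_space X A) (triv A i \<circ> (\<lambda>y. (f y, s y i)))"
    by (rule continuous_map_compose[OF _ continuous_map_triv[OF A i]])
  then show "continuous_map ?Z (total_space X A) (\<lambda>y. (f y, s y))"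
    by (rule continuous_map_eq) (use s i in \<open>auto simp: triv_coordinate charts_at_def\<close>)
next
  fix y assume "y \<in> topspace Y"
  then have "f y \<in> topspace X"
    using f by (auto simp: continuous_map_def)
  then show "\<exists>j. j \<in> charts A \<and> y \<in> {y \<in> topspace Y. f y \<in> patch A j} \<and> (f y, s y) = (f y, s y)"
    using A \<open>y \<in> topspace Y\<close> by (auto simp: unitary_vbundle_def)
qed auto

section \<open>Continuity of sections by coordinates\<close>

lemma continuous_sectionI:
  assumes "unitary_vbundle X A"
    and "\<And>x. x \<in> topspace X \<Longrightarrow> s x \<in> fibre A x"
    and "\<And>i. i \<in> charts A \<Longrightarrow> continuous_map (subtopology X (patch A i)) euclidean (\<lambda>x. s x i)"
  shows "continuous_section X A s"
  unfolding continuous_section_def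
proof (rule continuous_map_into_total_space[OF assms(1)])
  fix i assume "i \<in> charts A"
  then have "patch A i \<subseteq> topspace X"
    using assms(1) by (auto simp: unitary_vbundle_def)
  then have "{x \<in> topspace X. x \<in> patch A i} = patch A i"
    by auto
  then show "continuous_map (subtopology X {x \<in> topspace X. x \<in> patch A i}) euclidean (\<lambda>x. s x i)"
    using assms(3)[OF \<open>i \<in> charts A\<close>] by simp
qed (use assms(2) in auto)

lemma continuous_section_in_fibre:
  assumes "unitary_vbundle X A" "continuous_section X A s" "x \<in> topspace X"
  shows "s x \<in> fibre A x"
proof -
  have "(x, s x) \<in> topspace (total_space X A)"
    using assms(2,3) by (auto simp: continuous_section_def continuous_map_def)
  then show ?thesis
    by (simp add: topspace_total_space[OF assms(1)])
qed

lemma continuous_map_matrix_vector_mult: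
  fixes f :: "'b \<Rightarrow> complex^'n^'m"
  assumes f: "continuous_map Y euclidean f" and g: "continuous_map Y euclidean g"
  shows "continuous_map Y euclidean (\<lambda>y. f y *v g y)"
proof -
  have "continuous_on UNIV (\<lambda>p. (fst p :: complex^'n^'m) *v snd p)"
    unfolding matrix_vector_mult_def by (intro continuous_intros)
  then have "continuous_map (prod_topology euclidean euclidean) euclidean
      (\<lambda>p. (fst p :: complex^'n^'m) *v snd p)"
    by (simp flip: euclidean_product_topology)
  from continuous_map_compose[OF continuous_map_pairedI[OF f g] this] show ?thesis
    by (simp add: o_def)
qed

lemma continuous_section_coordinate:
  fixes A :: "('i, 'b, 'n::finite) vbundle"
  assumes A: "unitary_vbundle X A" and s: "continuous_section X A s" and i: "i \<in> charts A"
  shows "continuous_map (subtopology X (patch A i)) euclidean (\<lambda>x. s x i)"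
  unfolding continuous_map_def
proof (intro conjI allI impI)
  fix V :: "(complex^'n) set" assume "openin euclidean V"
  have opi: "openin X (patch A i)" and sub: "patch A i \<subseteq> topspace X"
    using A i by (auto simp: unitary_vbundle_def)
  \<comment> \<open>This is the set of vectors over \<open>patch A i\<close> whose
    \<open>i\<close>-th coordinate lies in \<open>V\<close>. Once it is open in the total space, the
    required preimage of \<open>V\<close> is its preimage under the section.\<close>
  define W where "W = {(x, v). x \<in> patch A i \<and> v \<in> fibre A x \<and> v i \<in> V}"
  have "openin (total_space X A) W"
    unfolding openin_total_space
  proof (intro conjI ballI)
    show "W \<subseteq> Sigma (topspace X) (fibre A)"
      using sub by (auto simp: W_def)
    fix j assume j: "j \<in> charts A"
    let ?Y = "prod_topology (subtopology X (patch A j)) (euclidean :: (complex^'n) topology)"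
    let ?Z = "subtopology ?Y (patch A i \<times> UNIV)"
    have opZ: "openin ?Y ((patch A j \<inter> patch A i) \<times> UNIV)"
      using A i j by (auto simp: unitary_vbundle_def openin_prod_Times_iff openin_subtopology_Int2)
    have Z: "?Z = prod_topology (subtopology X (patch A i \<inter> patch A j)) euclidean"
      by (simp add: prod_topology_subtopology subtopology_subtopology Int_commute Times_Int_Times)
    \<comment> \<open>In the \<open>j\<close>-th trivialization, \<open>W\<close> is the preimage of
      \<open>V\<close> under \<open>(x, v) \<mapsto> transition A i j x *v v\<close>. This is open
      over the overlap of the patches, and the overlap is open in \<open>patch A j\<close>.\<close>
    have "continuous_map (subtopology X (patch A i \<inter> patch A j)) euclidean (transition A i j)"
      using A i j by (auto simp: unitary_vbundle_def)
    from continuous_map_compose[OF continuous_map_fst this]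
    have "continuous_map ?Z euclidean (\<lambda>p. transition A i j (fst p) *v snd p)"
      unfolding Z o_def by (rule continuous_map_matrix_vector_mult[OF _ continuous_map_snd])
    then have "openin ?Z {p \<in> topspace ?Z. transition A i j (fst p) *v snd p \<in> V}"
      using \<open>openin euclidean V\<close> by (rule openin_continuous_map_preimage)
    then have "openin (subtopology ?Y (topspace ?Y \<inter> patch A i \<times> UNIV))
        {p \<in> topspace ?Z. transition A i j (fst p) *v snd p \<in> V}"
      by (simp only: subtopology_restrict)
    moreover have "openin ?Y (topspace ?Y \<inter> patch A i \<times> UNIV)"
    proof -
      have "topspace ?Y \<inter> patch A i \<times> UNIV = (patch A j \<inter> patch A i) \<times> UNIV"
        using sub by auto
      then show ?thesis
        using opZ by simp
    qed
    ultimately have "openin ?Y {p \<in> topspace ?Z. transition A i j (fst p) *v snd p \<in> V}"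
      by (rule openin_trans_full)
    moreover have "{p \<in> topspace ?Z. transition A i j (fst p) *v snd p \<in> V} =
        {p \<in> (topspace X \<inter> patch A j) \<times> UNIV. triv A j p \<in> W}"
    proof (rule Set.set_eqI)
      fix p :: "'b \<times> (complex^'n)"
      obtain x v where p: "p = (x, v)" by fastforce
      show "p \<in> {p \<in> topspace ?Z. transition A i j (fst p) *v snd p \<in> V} \<longleftrightarrow>
          p \<in> {p \<in> (topspace X \<inter> patch A j) \<times> UNIV. triv A j p \<in> W}"
      proof (cases "x \<in> topspace X \<and> x \<in> patch A j")
        case True
        then have "triv A j (x, v) \<in> Sigma (topspace X) (fibre A)"
          using triv_in_fibre[OF A j] by blast
        then show ?thesis
          using True i by (auto simp: p W_def triv_def charts_at_def)
      qed (auto simp: p)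
    qed
    ultimately show "openin ?Y {p \<in> (topspace X \<inter> patch A j) \<times> UNIV. triv A j p \<in> W}"
      by simp
  qed
  then have "openin X {x \<in> topspace X. (x, s x) \<in> W}"
    using s unfolding continuous_section_def by (rule openin_continuous_map_preimage[rotated])
  moreover have "{x \<in> topspace X. (x, s x) \<in> W} = {x \<in> topspace (subtopology X (patch A i)). s x i \<in> V}"
    using continuous_section_in_fibre[OF A s] by (auto simp: W_def)
  ultimately show "openin (subtopology X (patch A i)) {x \<in> topspace (subtopology X (patch A i)). s x i \<in> V}"
    unfolding openin_open_subtopology[OF opi] by auto
qed simp

section \<open>Vanishing of the second Chern class\<close>

lemma matrix_vector_mult_scaleR_complex:
  fixes M :: "complex^'n^'m"
  shows "M *v (r *\<^sub>R v) = r *\<^sub>R (M *v v)"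
  unfolding matrix_vector_mult_def vec_eq_iff by (simp add: scaleR_right.sum)
lemma scaleR_in_fibre:
  assumes v: "v \<in> fibre A x"
  shows "(\<lambda>i\<in>charts_at A x. r *\<^sub>R v i) \<in> fibre A x"
proof (rule fibreI)
  fix i j assume ij: "i \<in> charts_at A x" "j \<in> charts_at A x"
  then show "(\<lambda>i\<in>charts_at A x. r *\<^sub>R v i) i = transition A i j x *v (\<lambda>i\<in>charts_at A x. r *\<^sub>R v i) j"
    unfolding restrict_apply'[OF ij(1)] restrict_apply'[OF ij(2)] matrix_vector_mult_scaleR_complex
    by (intro arg_cong[where f = "scaleR r"] fibre_coordinate[OF v])
qed simp

text \<open>The zero section and \<open>s\<close> induce the same map into the homology of the total
  space relative to the nonzero vectors. The map of \<open>s\<close> factors through the nonzero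
  vectors relative to themselves, where homology is trivial, so the Thom class is evaluated at the
  neutral element.\<close>

lemma second_chern_class_eq_0:
  fixes A :: "('i, 'b, 2) vbundle"
  assumes A: "unitary_vbundle X A"
    and s: "continuous_section X A s" "nowhere_vanishing X A s"
    and c: "second_chern_class X A c"
    and z: "z \<in> carrier (homology_group 4 X)"
  shows "c z = 0"
proof -
  let ?E = "total_space X A" and ?N = "nonzero_part X A"
  let ?H = "relative_homology_group 4 ?E ?N"
  obtain u where "thom_class X A u \<and>
      (\<forall>z\<in>carrier (homology_group 4 X). c z = u (hom_induced 4 X {} ?E ?N (\<lambda>x. (x, fibre_zero A x)) z))"
    using c unfolding second_chern_class_def ..
  with z have u: "u \<in> hom ?H integer_group"
    and cu: "c z = u (hom_induced 4 X {} ?E ?N (\<lambda>x. (x, fibre_zero A x)) z)"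
    unfolding thom_class_def by simp_all
  have s_fibre: "s x \<in> fibre A x" if "x \<in> topspace X" for x
    using continuous_section_in_fibre[OF A s(1) that] .
  let ?I = "top_of_set {0..1::real}"
  \<comment> \<open>The parameter \<open>fst y\<close> scales the section from zero at time 0 to
    \<open>s\<close> at time 1.\<close>
  define h where "h = (\<lambda>y. \<lambda>i\<in>charts_at A (snd y). fst y *\<^sub>R s (snd y :: 'b) i)"
  have ch: "continuous_map (prod_topology ?I X) ?E (\<lambda>y. (snd y, h y))"
  proof (rule continuous_map_into_total_space[OF A])
    show "continuous_map (prod_topology ?I X) X snd"
      by (rule continuous_map_snd)
    show "h y \<in> fibre A (snd y)" if "y \<in> topspace (prod_topology ?I X)" for y
    proof -
      have "snd y \<in> topspace X"
        using that by auto
      then show ?thesis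
        unfolding h_def by (rule scaleR_in_fibre[OF s_fibre])
    qed
    fix i assume i: "i \<in> charts A"
    let ?Z = "subtopology (prod_topology ?I X) {y \<in> topspace (prod_topology ?I X). snd y \<in> patch A i}"
    have "continuous_map ?Z (subtopology X (patch A i)) snd"
      by (intro continuous_map_into_subtopology continuous_map_from_subtopology continuous_map_snd) auto
    from continuous_map_compose[OF this continuous_section_coordinate[OF A s(1) i]]
    have c2: "continuous_map ?Z euclidean (\<lambda>y. s (snd y) i)"
      by (simp add: o_def)
    have c1: "continuous_map ?Z euclidean fst"
      by (rule continuous_map_from_subtopology[OF continuous_map_into_fulltopology[OF continuous_map_fst]])
    have "continuous_on UNIV (\<lambda>p :: real \<times> (complex^2). fst p *\<^sub>R snd p)"
      by (intro continuous_intros)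
    then have "continuous_map (prod_topology euclidean euclidean) euclidean (\<lambda>p :: real \<times> (complex^2). fst p *\<^sub>R snd p)"
      by (simp flip: euclidean_product_topology)
    from continuous_map_compose[OF continuous_map_pairedI[OF c1 c2] this]
    have "continuous_map ?Z euclidean (\<lambda>y. fst y *\<^sub>R s (snd y) i)"
      by (simp add: o_def)
    then show "continuous_map ?Z euclidean (\<lambda>y. h y i)"
      by (rule continuous_map_eq) (use i in \<open>auto simp: h_def charts_at_def\<close>)
  qed
  \<comment> \<open>The source pair is \<open>(X, {})\<close>, so the homotopy may meet the zero
    section freely; the condition on its stages is vacuous.\<close>
  have "homotopic_with (\<lambda>h. h \<in> {} \<rightarrow> ?N) X ?E (\<lambda>x. (x, fibre_zero A x)) (\<lambda>x. (x, s x))"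
  proof (subst homotopic_with)
    show "\<exists>k. continuous_map (prod_topology ?I X) ?E k \<and>
        (\<forall>x\<in>topspace X. k (0, x) = (x, fibre_zero A x)) \<and> (\<forall>x\<in>topspace X. k (1, x) = (x, s x)) \<and>
        (\<forall>t\<in>{0..1}. (\<lambda>x. k (t, x)) \<in> {} \<rightarrow> ?N)"
    proof (intro exI[of _ "\<lambda>y. (snd y, h y)"] conjI ballI ch)
      fix x assume "x \<in> topspace X"
      then have "s x \<in> extensional (charts_at A x)"
        using s_fibre unfolding fibre_def by blast
      then show "(snd (1::real, x), h (1, x)) = (x, s x)"
        by (simp add: h_def extensional_restrict)
    qed (auto simp: h_def fibre_zero_def)
  qed auto
  then have eq: "hom_induced 4 X {} ?E ?N (\<lambda>x. (x, fibre_zero A x)) = hom_induced 4 X {} ?E ?N (\<lambda>x. (x, s x))"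
    by (rule homology_homotopy_axiom)
  let ?S = "subtopology ?E ?N"
  have cs: "continuous_map X ?S (\<lambda>x. (x, s x))"
    using s s_fibre unfolding continuous_section_def
    by (intro continuous_map_into_subtopology) (auto simp: nonzero_part_def nowhere_vanishing_def)
  \<comment> \<open>Within \<open>?S\<close> the subset \<open>?N\<close> contains all of the space,
    so this is the homology of a space relative to itself.\<close>
  have "trivial_group (relative_homology_group 4 ?S ?N)"
    using trivial_relative_homology_group_topspace[of 4 ?S]
    by (metis inf_right_idem relative_homology_group_restrict topspace_subtopology)
  then have 1: "hom_induced 4 X {} ?S ?N (\<lambda>x. (x, s x)) z = \<one>\<^bsub>relative_homology_group 4 ?S ?N\<^esub>"
    using hom_induced_carrier by (fastforce simp add: trivial_group_def)
  have "hom_induced 4 X {} ?E ?N (\<lambda>x. (x, s x)) z =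
      hom_induced 4 ?S ?N ?E ?N id (hom_induced 4 X {} ?S ?N (\<lambda>x. (x, s x)) z)"
    using hom_induced_compose'[OF cs, of "{}" ?N ?E id ?N 4 z] by (simp add: o_def)
  also have "\<dots> = \<one>\<^bsub>?H\<^esub>"
    by (simp add: 1 hom_one[OF hom_induced_hom])
  finally have "hom_induced 4 X {} ?E ?N (\<lambda>x. (x, s x)) z = \<one>\<^bsub>?H\<^esub>" .
  then show ?thesis
    using hom_one[OF u] by (simp add: cu eq)
qed

section \<open>Sections of tensor products\<close>

text \<open>The cocycle identity makes the matrix idempotent, and unitarity makes it
  invertible.\<close>

lemma transition_refl:
  assumes A: "unitary_vbundle X A" and i: "i \<in> charts_at A x"
  shows "transition A i i x = mat 1"
proof -
  let ?g = "transition A i i x"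
  have g: "?g ** ?g = ?g" "?g ** transpose (conj_mat ?g) = mat 1"
    using A i by (auto simp: unitary_vbundle_def charts_at_def unitary_mat_def)
  have "?g = (?g ** ?g) ** transpose (conj_mat ?g)"
    unfolding matrix_mul_assoc[symmetric] g(2) by simp
  then show ?thesis
    using g by simp
qed

text \<open>Both sides are inverse to \<open>transition A i j x\<close>. This is how unitarity
  identifies the conjugate bundle with the dual bundle, and hence its tensor product with
  \<open>A\<close> with the endomorphism bundle.\<close>

lemma adjoint_transition:
  assumes A: "unitary_vbundle X A" and ij: "i \<in> charts_at A x" "j \<in> charts_at A x"
  shows "transpose (conj_mat (transition A i j x)) = transition A j i x"
proof -
  let ?g = "transition A i j x"
  have "?g ** transition A j i x = mat 1"
    using A ij transition_refl[OF A ij(1)] by (simp add: unitary_vbundle_def charts_at_def)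
  moreover have "transpose (conj_mat ?g) ** ?g = mat 1"
    using A ij by (auto simp: unitary_vbundle_def charts_at_def unitary_mat_def)
  ultimately show ?thesis
    by (metis matrix_mul_assoc matrix_mul_lid matrix_mul_rid)
qed

lemma fibre_eq_fibre_zeroI:
  assumes v: "v \<in> fibre A x" and i: "i \<in> charts_at A x" "v i = 0"
  shows "v = fibre_zero A x"
proof (rule extensionalityI)
  show "v \<in> extensional (charts_at A x)"
    using v unfolding fibre_def by blast
  fix j assume j: "j \<in> charts_at A x"
  then show "v j = fibre_zero A x j"
    using fibre_coordinate[OF v j i(1)] i(2) by (simp add: fibre_zero_def)
qed (simp add: fibre_zero_def)

lemma scalar_mult_in_fibre:
  assumes v: "v \<in> fibre A x"
  shows "(\<lambda>i\<in>charts_at A x. c *s v i) \<in> fibre A x"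
proof (rule fibreI)
  fix i j assume ij: "i \<in> charts_at A x" "j \<in> charts_at A x"
  then show "(\<lambda>i\<in>charts_at A x. c *s v i) i = transition A i j x *v (\<lambda>i\<in>charts_at A x. c *s v i) j"
    unfolding restrict_apply'[OF ij(1)] restrict_apply'[OF ij(2)] vector_scalar_commute
    by (intro arg_cong[where f = "(*s) c"] fibre_coordinate[OF v])
qed simp

section \<open>The identity endomorphism as a section\<close>

lemma charts_at_tensor_vbundle: "charts_at (tensor_vbundle A B) x = charts_at A x \<times> charts_at B x"
  by (auto simp: charts_at_def tensor_vbundle_def)

lemma charts_at_conj_vbundle: "charts_at (conj_vbundle A) x = charts_at A x"
  by (simp add: charts_at_def conj_vbundle_def)

text \<open>Tensors are read as matrices here, so that coordinate changes of the tensor bundle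
  become two-sided multiplications, as for endomorphisms.\<close>

lemma tensor_mat_mult_vec:
  "tensor_mat M N *v (\<chi> p. Z $ fst p $ snd p) = (\<chi> p. (M ** Z ** transpose N) $ fst p $ snd p)"
proof -
  have "(\<Sum>q\<in>UNIV. M $ i $ fst q * N $ j $ snd q * Z $ fst q $ snd q) =
      (\<Sum>l\<in>UNIV. (\<Sum>k\<in>UNIV. M $ i $ k * Z $ k $ l) * N $ j $ l)" for i j
  proof -
    have "(\<Sum>q\<in>UNIV. M $ i $ fst q * N $ j $ snd q * Z $ fst q $ snd q) =
        (\<Sum>k\<in>UNIV. \<Sum>l\<in>UNIV. M $ i $ k * N $ j $ l * Z $ k $ l)"
      by (simp add: sum.cartesian_product case_prod_unfold)
    also have "\<dots> = (\<Sum>l\<in>UNIV. \<Sum>k\<in>UNIV. M $ i $ k * N $ j $ l * Z $ k $ l)"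
      by (rule sum.swap)
    finally show ?thesis
      by (simp add: sum_distrib_left sum_distrib_right mult_ac)
  qed
  then show ?thesis
    by (simp add: tensor_mat_def matrix_vector_mult_def matrix_matrix_mult_def transpose_def vec_eq_iff)
qed

lemma ex_nowhere_vanishing_section_tensor_conj:
  fixes A :: "('i, 'b, 'n::finite) vbundle"
  assumes A: "unitary_vbundle X A"
  shows "\<exists>\<Gamma>. continuous_section X (tensor_vbundle A (conj_vbundle A)) \<Gamma> \<and>
    nowhere_vanishing X (tensor_vbundle A (conj_vbundle A)) \<Gamma>"
proof -
  let ?T = "tensor_vbundle A (conj_vbundle A)"
  have T: "unitary_vbundle X ?T"
    by (intro unitary_vbundle_tensor unitary_vbundle_conj A)
  have at: "charts_at ?T x = charts_at A x \<times> charts_at A x" for x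
    by (simp add: charts_at_tensor_vbundle charts_at_conj_vbundle)
  \<comment> \<open>The two factors may be read in different charts: the identity, from coordinates
    in chart \<open>j\<close> to coordinates in chart \<open>i\<close>, has the transition matrix as
    its matrix.\<close>
  define I :: "'b \<Rightarrow> 'i \<times> 'i \<Rightarrow> complex^('n \<times> 'n)" where
    "I = (\<lambda>x. \<lambda>a\<in>charts_at ?T x. \<chi> p. transition A (fst a) (snd a) x $ fst p $ snd p)"
  have "continuous_section X ?T I"
  proof (rule continuous_sectionI[OF T])
    fix x
    show "I x \<in> fibre ?T x"
    proof (rule fibreI)
      show "I x \<in> extensional (charts_at ?T x)"
        by (simp add: I_def)
      fix a b assume ab: "a \<in> charts_at ?T x" "b \<in> charts_at ?T x"
      obtain i j k l where ij: "a = (i, j)" and kl: "b = (k, l)"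
        by fastforce
      have mem: "i \<in> charts_at A x" "j \<in> charts_at A x" "k \<in> charts_at A x" "l \<in> charts_at A x"
        using ab by (auto simp: at ij kl)
      \<comment> \<open>The compatibility of the coordinates of \<open>I\<close> is the cocycle
        identity applied twice, with the last factor rewritten as an adjoint.\<close>
      have "transition A i k x ** transition A k l x ** transition A l j x = transition A i j x"
        using A mem by (simp add: unitary_vbundle_def charts_at_def)
      then have "transition A i k x ** transition A k l x ** transpose (conj_mat (transition A j l x)) =
          transition A i j x"
        by (simp add: adjoint_transition[OF A mem(2,4)])
      then have "(\<chi> p. transition A i j x $ fst p $ snd p) =
          tensor_mat (transition A i k x) (conj_mat (transition A j l x)) *v
            (\<chi> p. transition A k l x $ fst p $ snd p)"
        by (simp add: tensor_mat_mult_vec)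
      moreover have "transition ?T a b x = tensor_mat (transition A i k x) (conj_mat (transition A j l x))"
        by (simp add: ij kl tensor_vbundle_def conj_vbundle_def)
      ultimately show "I x a = transition ?T a b x *v I x b"
        using ab by (simp add: I_def ij kl)
    qed
  next
    fix a assume a: "a \<in> charts ?T"
    obtain i j where ij: "a = (i, j)" "i \<in> charts A" "j \<in> charts A"
      using a by (auto simp: tensor_vbundle_def conj_vbundle_def)
    have patch: "patch ?T a = patch A i \<inter> patch A j"
      by (simp add: ij tensor_vbundle_def conj_vbundle_def)
    have "continuous_map (subtopology X (patch ?T a)) euclidean (transition A i j)"
      unfolding patch using A ij(2,3) by (simp add: unitary_vbundle_def)
    moreover have "continuous_map euclidean euclidean (\<lambda>M :: complex^'n^'n. \<chi> p. M $ fst p $ snd p)"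
      unfolding continuous_map_iff_continuous2 by (intro continuous_intros)
    ultimately have "continuous_map (subtopology X (patch ?T a)) euclidean
        ((\<lambda>M. \<chi> p. M $ fst p $ snd p) \<circ> transition A i j)"
      by (rule continuous_map_compose)
    then show "continuous_map (subtopology X (patch ?T a)) euclidean (\<lambda>x. I x a)"
      by (rule continuous_map_eq) (use a in \<open>simp add: I_def charts_at_def ij(1)\<close>)
  qed
  moreover have "nowhere_vanishing X ?T I"
    unfolding nowhere_vanishing_def
  proof
    fix x assume "x \<in> topspace X"
    then have "x \<in> (\<Union>i\<in>charts A. patch A i)"
      using A by (simp add: unitary_vbundle_def)
    then obtain i where i: "i \<in> charts_at A x"
      by (auto simp: charts_at_def)
    \<comment> \<open>With the same chart on both sides the coordinate is the identity matrix, whose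
      diagonal entries are not 0.\<close>
    have "I x (i, i) $ (p, p) = 1" for p
      using i by (simp add: I_def at transition_refl[OF A i] mat_def)
    moreover have "fibre_zero ?T x (i, i) = 0"
      using i by (simp add: fibre_zero_def at)
    ultimately show "I x \<noteq> fibre_zero ?T x"
      by (metis zero_index zero_neq_one)
  qed
  ultimately show ?thesis
    by blast
qed

text \<open>The factors \<open>v\<close> and \<open>w\<close> are chosen pointwise and need not be
  continuous, but the products \<open>v_p w_q\<close> are, being the entries of
  \<open>\<Gamma>\<close>. Where \<open>w_q\<close> is nonzero, \<open>w_q v\<close> is a continuous
  local frame of the line spanned by \<open>v\<close>, so the entries of \<open>w\<close> form the
  cocycle of this line subbundle. A trivializing \<open>t\<close> then gives the section
  \<open>t v\<close> of \<open>A\<close>.\<close>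

lemma ex_nowhere_vanishing_section_if_simple:
  fixes A :: "('i, real^5, 'n::finite) vbundle" and B :: "('j, real^5, 'm::finite) vbundle"
  assumes A: "unitary_vbundle S4 A" and B: "unitary_vbundle S4 B"
    and \<Gamma>: "continuous_section S4 (tensor_vbundle A B) \<Gamma>"
    and simple: "\<And>x. x \<in> topspace S4 \<Longrightarrow> simple_at A B x (\<Gamma> x)"
  shows "\<exists>s. continuous_section S4 A s \<and> nowhere_vanishing S4 A s"
proof -
  let ?S = "sphere 0 1 :: (real^5) set"
  have opA: "openin S4 (patch A i)" if "i \<in> charts A" for i
    using A that by (simp add: unitary_vbundle_def)
  have opB: "openin S4 (patch B j)" if "j \<in> charts B" for j
    using B that by (simp add: unitary_vbundle_def)
  have covA: "(\<Union>i\<in>charts A. patch A i) = ?S" and covB: "(\<Union>j\<in>charts B. patch B j) = ?S"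
    using A B by (simp_all add: unitary_vbundle_def)
  have "\<exists>v w. v \<in> fibre A x \<and> w \<in> fibre B x \<and> \<Gamma> x = fibre_tensor A B x v w" if "x \<in> ?S" for x
    using simple[of x] that unfolding simple_at_def by auto
  then obtain v w where v: "\<And>x. x \<in> ?S \<Longrightarrow> v x \<in> fibre A x" and w: "\<And>x. x \<in> ?S \<Longrightarrow> w x \<in> fibre B x"
    and vw: "\<And>x. x \<in> ?S \<Longrightarrow> \<Gamma> x = fibre_tensor A B x (v x) (w x)"
    by metis
  have \<Gamma>_eq: "\<Gamma> x (i, j) = tensor_vec (v x i) (w x j)"
    if "i \<in> charts A" "j \<in> charts B" "x \<in> patch A i" "x \<in> patch B j" for i j x
  proof -
    have "x \<in> ?S" using covA that by blast
    then show ?thesis using vw[of x] that by (simp add: fibre_tensor_def charts_at_def)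
  qed
  have \<Gamma>_comp: "\<Gamma> x (i, j) $ (p, q) = v x i $ p * w x j $ q"
    if "i \<in> charts A" "j \<in> charts B" "x \<in> patch A i" "x \<in> patch B j" for i j p q x
    using \<Gamma>_eq[OF that] by (simp add: tensor_vec_def)
  \<comment> \<open>A fibre vector with one vanishing coordinate is zero, so a nonzero tensor has
    nonzero factors in every chart.\<close>
  have nz: "v x i \<noteq> 0 \<and> w x j \<noteq> 0"
    if ij: "i \<in> charts A" "j \<in> charts B" "x \<in> patch A i" "x \<in> patch B j" for i j x
  proof -
    have x: "x \<in> ?S" using covA that by blast
    have "\<Gamma> x \<noteq> fibre_zero (tensor_vbundle A B) x" "\<Gamma> x \<in> fibre (tensor_vbundle A B) x"
      using simple[of x] x vw[OF x] fibre_tensor_in_fibre[OF v[OF x] w[OF x]] by (auto simp: simple_at_def)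
    moreover have "(i, j) \<in> charts_at (tensor_vbundle A B) x"
      unfolding charts_at_tensor_vbundle by (simp add: charts_at_def ij)
    ultimately have "\<Gamma> x (i, j) \<noteq> 0"
      using fibre_eq_fibre_zeroI[of "\<Gamma> x" "tensor_vbundle A B" x "(i, j)"] by blast
    then show ?thesis
      using \<Gamma>_eq[OF ij] by (auto simp: tensor_vec_def vec_eq_iff)
  qed
  have cont: "continuous_on (patch A i \<inter> patch B j) (\<lambda>x. \<Gamma> x (i, j) $ (p, q))"
    if ij: "i \<in> charts A" "j \<in> charts B" for i j p q
  proof -
    have "continuous_map (subtopology S4 (patch A i \<inter> patch B j)) euclidean (\<lambda>x. \<Gamma> x (i, j))"
      using continuous_section_coordinate[OF unitary_vbundle_tensor[OF A B] \<Gamma>, of "(i, j)"] ij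
      by (simp add: tensor_vbundle_def)
    moreover have "?S \<inter> (patch A i \<inter> patch B j) = patch A i \<inter> patch B j"
      using covA ij by blast
    ultimately have "continuous_on (patch A i \<inter> patch B j) (\<lambda>x. \<Gamma> x (i, j))"
      by (simp add: subtopology_subtopology)
    then show ?thesis
      by (rule continuous_on_component)
  qed
  \<comment> \<open>An index names a chart of each bundle and the entry \<open>q\<close> of
    \<open>w\<close> that is used for the frame. The chart of \<open>A\<close> is included so that
    the entries of \<open>\<Gamma>\<close> are available on the whole patch.\<close>
  define I where "I = charts A \<times> charts B \<times> (UNIV :: 'm set)"
  define U where "U = (\<lambda>(i, j, q). {x \<in> patch A i \<inter> patch B j. w x j $ q \<noteq> 0})"
  \<comment> \<open>Openness of \<open>U\<close> cannot be read off from \<open>w\<close>. On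
    \<open>N\<close> also \<open>v_p\<close> is nonzero, and since \<open>v\<close> has no zeros
    these open sets exhaust \<open>U\<close> as \<open>p\<close> varies.\<close>
  define N where "N = (\<lambda>i j p q. {x \<in> patch A i \<inter> patch B j. \<Gamma> x (i, j) $ (p, q) \<noteq> 0})"
  have opN: "openin S4 (N i j p q)" if ij: "i \<in> charts A" "j \<in> charts B" for i j p q
  proof -
    have "openin (top_of_set (patch A i \<inter> patch B j))
        (patch A i \<inter> patch B j \<inter> (\<lambda>x. \<Gamma> x (i, j) $ (p, q)) -` (- {0}))"
      by (intro continuous_openin_preimage_gen cont[OF ij] open_Compl closed_singleton)
    moreover have "patch A i \<inter> patch B j \<inter> (\<lambda>x. \<Gamma> x (i, j) $ (p, q)) -` (- {0}) = N i j p q"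
      by (auto simp: N_def)
    ultimately show ?thesis
      using openin_Int[OF opA[OF ij(1)] opB[OF ij(2)]] by (metis openin_trans)
  qed
  have U_eq: "U (i, j, q) = (\<Union>p. N i j p q)" if ij: "i \<in> charts A" "j \<in> charts B" for i j q
    using nz[OF ij] by (auto simp: U_def N_def \<Gamma>_comp[OF ij] vec_eq_iff)
  interpret nonzero_cocycle ?S I U "\<lambda>(i, j, q) x. w x j $ q"
  proof
    show "openin S4 (U a)" if "a \<in> I" for a
      using that by (auto simp: I_def U_eq intro!: openin_Union opN)
    show "?S \<subseteq> (\<Union>a\<in>I. U a)"
    proof
      fix x assume x: "x \<in> ?S"
      then obtain i j where ij: "i \<in> charts A" "j \<in> charts B" "x \<in> patch A i" "x \<in> patch B j"
        using covA covB by blast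
      then obtain q where "w x j $ q \<noteq> 0"
        using nz[OF ij] by (auto simp: vec_eq_iff)
      then show "x \<in> (\<Union>a\<in>I. U a)"
        using ij by (force simp: I_def U_def)
    qed
    show "(case a of (i, j, q) \<Rightarrow> \<lambda>x. w x j $ q) x \<noteq> 0" if "a \<in> I" "x \<in> U a" for a x
      using that by (auto simp: U_def)
    fix a b assume ab: "a \<in> I" "b \<in> I"
    obtain i j q k l r where a: "a = (i, j, q)" and b: "b = (k, l, r)"
      by (metis prod_cases3)
    have mem: "i \<in> charts A" "j \<in> charts B" "k \<in> charts A" "l \<in> charts B"
      using ab by (auto simp: a b I_def)
    have "continuous_on (U a \<inter> U b) (\<lambda>x. w x l $ r / w x j $ q)"
    proof (rule continuous_on_openin_cover[where I = UNIV and U = "\<lambda>p. N i j p q"])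
      fix p
      have "U a \<inter> U b \<subseteq> ?S"
        using covA mem by (auto simp: U_def a)
      then show "openin (top_of_set (U a \<inter> U b)) (U a \<inter> U b \<inter> N i j p q)"
        using openin_subtopology_Int2[OF opN[OF mem(1,2)]]
        by (metis inf.absorb_iff2 openin_subtopology_Int2 subtopology_subtopology)
      \<comment> \<open>Both entries of \<open>\<Gamma>\<close> contain the same factor
        \<open>v x i $ p\<close>, which cancels and leaves the ratio of entries of
        \<open>w\<close>.\<close>
      have "continuous_on (U a \<inter> U b \<inter> N i j p q) (\<lambda>x. \<Gamma> x (i, l) $ (p, r) / \<Gamma> x (i, j) $ (p, q))"
        by (intro continuous_on_divide continuous_on_subset[OF cont[OF mem(1,4)]]
            continuous_on_subset[OF cont[OF mem(1,2)]]) (auto simp: U_def N_def a b)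
      then show "continuous_on (U a \<inter> U b \<inter> N i j p q) (\<lambda>x. w x l $ r / w x j $ q)"
        by (rule continuous_on_eq) (auto simp: U_def N_def a b \<Gamma>_comp mem)
    qed (use U_eq[OF mem(1,2)] in \<open>auto simp: a\<close>)
    then show "continuous_on (U a \<inter> U b)
        (\<lambda>x. (case b of (i, j, q) \<Rightarrow> \<lambda>x. w x j $ q) x / (case a of (i, j, q) \<Rightarrow> \<lambda>x. w x j $ q) x)"
      by (simp add: a b)
  qed
  \<comment> \<open>The stereographic chart of the 4-sphere is \<open>real^4\<close>, so the last
    gluing is along a 3-sphere.\<close>
  have "trivial_on ?S"
    by (rule trivial_on_sphere[where 'b = "real^4"]) simp_all
  then obtain t where t: "\<And>x. x \<in> ?S \<Longrightarrow> t x \<noteq> 0"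
    and ct: "\<And>a. a \<in> I \<Longrightarrow> continuous_on (?S \<inter> U a) (\<lambda>x. t x / (case a of (i, j, q) \<Rightarrow> \<lambda>x. w x j $ q) x)"
    unfolding trivial_on_def by blast
  define s where "s = (\<lambda>x. \<lambda>i\<in>charts_at A x. t x *s v x i)"
  have "continuous_section S4 A s"
  proof (rule continuous_sectionI[OF A])
    show "s x \<in> fibre A x" if "x \<in> topspace S4" for x
      unfolding s_def using that by (intro scalar_mult_in_fibre v) simp
    fix i assume i: "i \<in> charts A"
    then have sub: "patch A i \<subseteq> ?S"
      using covA by blast
    have "continuous_on (patch A i) (\<lambda>x. t x *s v x i)"
    proof (rule continuous_on_openin_cover[where I = "charts B \<times> UNIV" and U = "\<lambda>(j, q). U (i, j, q)"])
      show "patch A i \<subseteq> (\<Union>b\<in>charts B \<times> UNIV. case b of (j, q) \<Rightarrow> U (i, j, q))"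
      proof
        fix x assume x: "x \<in> patch A i"
        then obtain j where j: "j \<in> charts B" "x \<in> patch B j"
          using sub covB by blast
        obtain q where "w x j $ q \<noteq> 0"
          using nz[OF i j(1) x j(2)] by (auto simp: vec_eq_iff)
        then show "x \<in> (\<Union>b\<in>charts B \<times> UNIV. case b of (j, q) \<Rightarrow> U (i, j, q))"
          using x j by (force simp: U_def)
      qed
      fix b assume "b \<in> charts B \<times> (UNIV :: 'm set)"
      then obtain j q where b: "b = (j, q)" and j: "j \<in> charts B"
        by auto
      have ijq: "(i, j, q) \<in> I"
        using i j by (simp add: I_def)
      have U_sub: "U (i, j, q) \<subseteq> patch A i"
        by (auto simp: U_def)
      then have "openin (top_of_set (patch A i)) (U (i, j, q))"
        using openin_U[OF ijq] sub openin_subset_trans by blast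
      then show "openin (top_of_set (patch A i)) (patch A i \<inter> (case b of (j, q) \<Rightarrow> U (i, j, q)))"
        using U_sub by (simp add: b Int_absorb1)
      have "continuous_on (?S \<inter> U (i, j, q)) (\<lambda>x. t x / w x j $ q)"
        using ct[OF ijq] by simp
      then have "continuous_on (U (i, j, q)) (\<lambda>x. t x / w x j $ q)"
        by (rule continuous_on_subset) (use U_sub sub in blast)
      moreover have "continuous_on (U (i, j, q)) (\<lambda>x. \<Gamma> x (i, j) $ (p, q))" for p
        by (rule continuous_on_subset[OF cont[OF i j]]) (auto simp: U_def)
      \<comment> \<open>The unknown continuity of \<open>t\<close> and \<open>v\<close> is bypassed
        by writing \<open>t v\<close> as \<open>t / w_q\<close> times \<open>w_q v\<close>: the
        first factor is continuous by the choice of \<open>t\<close>, the second consists of entries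
        of \<open>\<Gamma>\<close>.\<close>
      ultimately have "continuous_on (U (i, j, q)) (\<lambda>x. \<chi> p. t x / w x j $ q * \<Gamma> x (i, j) $ (p, q))"
        by (intro continuous_on_vec_lambda continuous_on_mult)
      then have "continuous_on (U (i, j, q)) (\<lambda>x. t x *s v x i)"
        by (rule continuous_on_eq) (auto simp: U_def \<Gamma>_comp[OF i j] vec_eq_iff)
      then show "continuous_on (patch A i \<inter> (case b of (j, q) \<Rightarrow> U (i, j, q))) (\<lambda>x. t x *s v x i)"
        using U_sub by (simp add: b Int_absorb1)
    qed
    then have "continuous_on (patch A i) (\<lambda>x. s x i)"
      by (rule continuous_on_eq) (use i in \<open>auto simp: s_def charts_at_def\<close>)
    then show "continuous_map (subtopology S4 (patch A i)) euclidean (\<lambda>x. s x i)"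
      using sub by (simp add: subtopology_subtopology Int_absorb1)
  qed
  moreover have "nowhere_vanishing S4 A s"
    unfolding nowhere_vanishing_def
  proof
    fix x assume "x \<in> topspace S4"
    then have x: "x \<in> ?S" by simp
    then obtain i j where ij: "i \<in> charts A" "j \<in> charts B" "x \<in> patch A i" "x \<in> patch B j"
      using covA covB by blast
    then have "s x i \<noteq> 0"
      using nz[OF ij] t[OF x] by (auto simp: s_def charts_at_def vec_eq_iff)
    then show "s x \<noteq> fibre_zero A x"
      using ij by (auto simp: fibre_zero_def charts_at_def)
  qed
  ultimately show ?thesis
    by blast
qed

theorem mainTheorem1:
  fixes A :: "('i, real^5, 2) vbundle"
    and c :: "(real^5) chain set \<Rightarrow> int"
    and z :: "(real^5) chain set"
  assumes "unitary_vbundle S4 A"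
    and "orientation_class S4 4 z"
    and "second_chern_class S4 A c"
    and "c z = 1"
  shows "(\<exists>\<Gamma>. continuous_section S4 (tensor_vbundle A (conj_vbundle A)) \<Gamma> \<and>
              nowhere_vanishing S4 (tensor_vbundle A (conj_vbundle A)) \<Gamma>) \<and>
         (\<forall>\<Gamma>. continuous_section S4 (tensor_vbundle A (conj_vbundle A)) \<Gamma> \<and>
              nowhere_vanishing S4 (tensor_vbundle A (conj_vbundle A)) \<Gamma> \<longrightarrow>
              (\<exists>x\<in>topspace S4. entangled_at A (conj_vbundle A) x (\<Gamma> x)))"
proof (intro conjI allI impI)
  show "\<exists>\<Gamma>. continuous_section S4 (tensor_vbundle A (conj_vbundle A)) \<Gamma> \<and>
      nowhere_vanishing S4 (tensor_vbundle A (conj_vbundle A)) \<Gamma>"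
    by (rule ex_nowhere_vanishing_section_tensor_conj[OF assms(1)])
  fix \<Gamma> assume \<Gamma>: "continuous_section S4 (tensor_vbundle A (conj_vbundle A)) \<Gamma> \<and>
      nowhere_vanishing S4 (tensor_vbundle A (conj_vbundle A)) \<Gamma>"
  note B = unitary_vbundle_conj[OF assms(1)]
  show "\<exists>x\<in>topspace S4. entangled_at A (conj_vbundle A) x (\<Gamma> x)"
  proof (rule ccontr)
    assume "\<not> ?thesis"
    \<comment> \<open>The values of \<open>\<Gamma>\<close> are nonzero vectors of the fibres, so
      failing to be entangled leaves only simple values.\<close>
    then have "simple_at A (conj_vbundle A) x (\<Gamma> x)" if "x \<in> topspace S4" for x
      using that \<Gamma> continuous_section_in_fibre[OF unitary_vbundle_tensor[OF assms(1) B], of \<Gamma> x]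
      unfolding entangled_at_def nowhere_vanishing_def by blast
    then obtain s where "continuous_section S4 A s" "nowhere_vanishing S4 A s"
      using ex_nowhere_vanishing_section_if_simple[OF assms(1) B] \<Gamma> by blast
    moreover have "z \<in> carrier (homology_group 4 S4)"
      using assms(2) by (simp add: orientation_class_def)
    ultimately have "c z = 0"
      using second_chern_class_eq_0[OF assms(1) _ _ assms(3)] by blast
    then show False
      using assms(4) by simp
  qed
qed

end
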